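(* Steiner symmetrization need not increase $\rho_1$ or $\rho_2$: for each $j\in\{1,2\}$ there exist a bounded simply connected region $\Omega\subseteq\mathbb{C}$ whose boundary is a Jordan curve and a line $\ell$ such that the Steiner symmetrization $\Omega'$ of $\Omega$ with respect to $\ell$ satisfies $\rho_j(\Omega')<\rho_j(\Omega)$.
   Context: For a bounded simply connected region $\Omega\subseteq\mathbb{C}$ and $N\in\mathbb{N}$, let $\mathcal{P}_N$ be the space of complex polynomials in $z$ of degree at most $N$, and let $dA$ denote area measure. Define $$\rho_N(\Omega):=\min_{p\in\mathcal{P}_N}\int_\Omega|\bar z-p(z)|^2\,dA(z),$$ the square of the distance from $\bar z$ to $\mathcal{P}_N$ in $L^2(\Omega,dA)$. Steiner symmetrization of $\Omega$ with respect to a line $\ell$ replaces, for every line $\ell'$ perpendicular to $\ell$ that meets $\Omega$, the intersection $\ell'\cap\Omega$ by a line segment contained in $\ell'$, centered on $\ell$, and having length equal to the one-dimensional Lebesgue measure of $\ell'\cap\Omega$; the resulting region is $\Omega'$. *)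

theory Defs
  imports "HOL-Analysis.Analysis" "HOL-Computational_Algebra.Polynomial"
begin

(* The infimum is a minimum: it is the squared L2(\<Omega>)-distance from cnj to a
   finite-dimensional subspace (for bounded open \<Omega>, where everything is integrable). *)
definition rho :: "nat \<Rightarrow> complex set \<Rightarrow> real" where
  "rho N \<Omega> = (INF p \<in> {p :: complex poly. degree p \<le> N}.
     LINT z:\<Omega>|lebesgue. (cmod (cnj z - poly p z))\<^sup>2)"

(* For norm u = 1, the line l through a with direction u has the arc-length
   parametrization s \<mapsto> a + s u, and the perpendicular to l at that point is
   t \<mapsto> a + (s + \<i> t) u, again by arc length, with t = 0 the point on l. *)
definition perp_line :: "complex \<Rightarrow> complex \<Rightarrow> real \<Rightarrow> real \<Rightarrow> complex" where
  "perp_line a u s t = a + Complex s t * u"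

(* Steiner symmetrization with respect to the line through a with direction u (norm u = 1).
   The segments are open, so that a region is mapped to a region. *)
definition steiner_symmetrization :: "complex \<Rightarrow> complex \<Rightarrow> complex set \<Rightarrow> complex set" where
  "steiner_symmetrization a u \<Omega> =
     {perp_line a u s t | s t.
        range (perp_line a u s) \<inter> \<Omega> \<noteq> {} \<and>
        \<bar>t\<bar> < measure lebesgue {t'. perp_line a u s t' \<in> \<Omega>} / 2}"

definition jordan_curve :: "complex set \<Rightarrow> bool" where
  "jordan_curve C \<longleftrightarrow>
     (\<exists>\<gamma>. simple_path \<gamma> \<and> pathfinish \<gamma> = pathstart \<gamma> \<and> path_image \<gamma> = C)"

end

theory Submission
  imports Defs
begin

text \<open>
  Let \<open>\<Omega>\<close> be a strip of half height \<open>h\<close> around the graph of a continuous \<open>f\<close>. Symmetrization in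
  the real axis straightens it to a rectangle, on which \<open>p(z) = z\<close> shows \<open>\<rho>\<^sub>j = O(h\<^sup>3)\<close>. If
  the graph passes through the points \<open>\<i>\<^sup>k a\<close>, then \<open>\<rho>\<^sub>j(\<Omega>)\<close> is at least of order \<open>h\<^sup>2\<close> for
  \<open>j \<le> 2\<close>: the functional \<open>g \<mapsto> \<Sum>k<4. \<i>\<^sup>k g(\<i>\<^sup>k a + w)\<close> kills every polynomial of degree at
  most 2 but maps \<open>cnj\<close> to \<open>4 cnj a\<close>, and \<open>w\<close> may range over a square of side comparable to \<open>h\<close>.
\<close>

section \<open>Strips around graphs\<close>

text \<open>For continuous \<open>f\<close> this is a homeomorphism of the whole plane, with inverse
  \<open>shear (\<lambda>x. - f x)\<close>, so the topology of a strip can be read off from an open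
  rectangle.\<close>

definition shear :: "(real \<Rightarrow> real) \<Rightarrow> complex \<Rightarrow> complex" where
  "shear f z = Complex (Re z) (Im z + f (Re z))"

definition graph_strip :: "real \<Rightarrow> real \<Rightarrow> (real \<Rightarrow> real) \<Rightarrow> complex set" where
  "graph_strip b h f = {z. \<bar>Re z\<bar> < b \<and> \<bar>Im z - f (Re z)\<bar> < h}"

lemma continuous_on_shear:
  assumes "continuous_on UNIV f"
  shows "continuous_on A (shear f)"
proof -
  have "continuous_on A (\<lambda>z. f (Re z))"
    using continuous_on_compose2[OF assms continuous_on_Re[OF continuous_on_id]] by simp
  then show ?thesis
    unfolding shear_def [abs_def] Complex_eq by (intro continuous_intros)
qed

lemma homeomorphism_shear:
  assumes "continuous_on UNIV f"
  shows "homeomorphism A (shear f ` A) (shear f) (shear (\<lambda>x. - f x))"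
proof -
  have inv: "shear (\<lambda>x. - f x) (shear f z) = z" for z
    by (simp add: shear_def)
  show ?thesis
    by (auto simp: homeomorphism_def inv image_image
        intro!: continuous_on_shear continuous_on_minus assms)
qed

lemma graph_strip_eq_shear:
  "graph_strip b h f = shear f ` box (Complex (- b) (- h)) (Complex b h)"
proof -
  have "z \<in> shear f ` box (Complex (- b) (- h)) (Complex b h)" if "z \<in> graph_strip b h f" for z
    using that
    by (intro image_eqI[of _ _ "Complex (Re z) (Im z - f (Re z))"])
      (auto simp: graph_strip_def shear_def in_box_complex_iff)
  then show ?thesis
    by (auto simp: graph_strip_def shear_def in_box_complex_iff)
qed

lemma open_graph_strip:
  assumes "continuous_on UNIV f"
  shows "open (graph_strip b h f)"
proof -
  have "continuous_on UNIV (\<lambda>z. f (Re z))"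
    using continuous_on_compose2[OF assms continuous_on_Re[OF continuous_on_id]] by simp
  then show ?thesis
    unfolding graph_strip_def by (intro open_Collect_conj open_Collect_less continuous_intros)
qed

lemma bounded_graph_strip:
  assumes "continuous_on UNIV f"
  shows "bounded (graph_strip b h f)"
proof -
  let ?A = "cbox (Complex (- b) (- h)) (Complex b h)"
  have "compact (shear f ` ?A)"
    by (intro compact_continuous_image continuous_on_shear assms compact_cbox)
  then show ?thesis
    unfolding graph_strip_eq_shear
    by (meson bounded_subset box_subset_cbox compact_imp_bounded image_mono)
qed

lemma simply_connected_graph_strip:
  assumes "continuous_on UNIV f"
  shows "simply_connected (graph_strip b h f)"
  unfolding graph_strip_eq_shear
  using homeomorphic_simply_connected[OF _ convex_imp_simply_connected[OF convex_box(2)]]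
    homeomorphism_shear[OF assms] homeomorphic_def by blast

text \<open>A homeomorphism of the plane commutes with \<open>frontier\<close>, so the rectangle's
  boundary path, composed with the shear, is the required simple closed path.\<close>

lemma jordan_curve_frontier_graph_strip:
  assumes f: "continuous_on UNIV f" and "b > 0" "h > 0"
  shows "jordan_curve (frontier (graph_strip b h f))"
proof -
  let ?u = "Complex (- b) (- h)" and ?v = "Complex b h"
  let ?g = "rectpath ?u ?v"
  have surj: "shear f ` UNIV = UNIV"
    by (rule surjI[of _ "shear (\<lambda>x. - f x)"]) (simp add: shear_def)
  have inj: "inj (shear f)"
    by (rule inj_on_inverseI[of _ "shear (\<lambda>x. - f x)"]) (simp add: shear_def)
  have "homeomorphism UNIV UNIV (shear f) (shear (\<lambda>x. - f x))"
    using homeomorphism_shear[OF f, of UNIV] surj by simp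
  then have "homeomorphic_map euclidean euclidean (shear f)"
    by (auto simp: homeomorphic_map_maps homeomorphic_maps_def homeomorphism_def)
  then have "frontier (graph_strip b h f) = shear f ` frontier (box ?u ?v)"
    unfolding graph_strip_eq_shear
    using homeomorphic_map_frontier_of[of euclidean euclidean "shear f" "box ?u ?v"]
    by (simp add: euclidean_frontier_of)
  also have "box ?u ?v \<noteq> {}"
    using assms by (auto simp: box_eq_empty Basis_complex_def)
  then have "frontier (box ?u ?v) = path_image ?g"
    using assms by (simp add: frontier_box path_image_rectpath_cbox_minus_box)
  finally have "frontier (graph_strip b h f) = path_image (shear f \<circ> ?g)"
    by (simp add: path_image_compose)
  moreover have "simple_path (shear f \<circ> ?g)"
    using assms inj
    by (intro simple_path_continuous_image simple_path_rectpath continuous_on_shear)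
      (auto intro: inj_on_subset)
  ultimately show ?thesis
    unfolding jordan_curve_def
    by (intro exI[of _ "shear f \<circ> ?g"]) (simp add: pathstart_compose pathfinish_compose)
qed

text \<open>Each vertical slice over \<open>\<bar>s\<bar> < b\<close> is an interval of length
  \<open>2 * h\<close> centered at \<open>f s\<close>; recentering it on the real axis removes
  \<open>f\<close>.\<close>

lemma steiner_symmetrization_graph_strip:
  assumes "h > 0"
  shows "steiner_symmetrization 0 1 (graph_strip b h f) = graph_strip b h (\<lambda>_. 0)"
proof -
  have meets: "range (perp_line 0 1 s) \<inter> graph_strip b h f \<noteq> {} \<longleftrightarrow> \<bar>s\<bar> < b" for s
  proof
    assume "\<bar>s\<bar> < b"
    then have "perp_line 0 1 s (f s) \<in> graph_strip b h f"
      using assms by (simp add: perp_line_def graph_strip_def)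
    then show "range (perp_line 0 1 s) \<inter> graph_strip b h f \<noteq> {}" by blast
  qed (auto simp: perp_line_def graph_strip_def)
  have "measure lebesgue {t. perp_line 0 1 s t \<in> graph_strip b h f} = 2 * h" if "\<bar>s\<bar> < b" for s
  proof -
    have "{t. perp_line 0 1 s t \<in> graph_strip b h f} = {f s - h<..<f s + h}"
      using that by (auto simp: perp_line_def graph_strip_def)
    then show ?thesis using assms by simp
  qed
  then have "steiner_symmetrization 0 1 (graph_strip b h f) = {Complex s t | s t. \<bar>s\<bar> < b \<and> \<bar>t\<bar> < h}"
    unfolding steiner_symmetrization_def meets
    by (force simp: perp_line_def)
  also have "\<dots> = graph_strip b h (\<lambda>_. 0)"
    by (auto simp: graph_strip_def complex_eq_iff intro: exI[of _ "Re _"])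
  finally show ?thesis .
qed

section \<open>Bounds for the approximation error\<close>

lemma continuous_on_error:
  "continuous_on A (\<lambda>z. (cmod (cnj z - poly p z))\<^sup>2)"
  by (intro continuous_intros)

lemma set_integrable_bounded_open:
  fixes F :: "complex \<Rightarrow> real"
  assumes "open \<Omega>" "bounded \<Omega>" "continuous_on UNIV F"
  shows "set_integrable lebesgue \<Omega> F"
proof -
  obtain u v where "\<Omega> \<subseteq> cbox u v"
    using bounded_subset_cbox_symmetric[OF \<open>bounded \<Omega>\<close>] by blast
  moreover have "set_integrable lebesgue (cbox u v) F"
    using absolutely_integrable_continuous assms(3) continuous_on_subset by blast
  ultimately show ?thesis
    using set_integrable_subset assms(1) by (metis borel_open sets_completionI_sets sets_lborel)
qed

lemma set_integral_error_nonneg: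
  "0 \<le> (LINT z:\<Omega>|lebesgue. (cmod (cnj z - poly p z))\<^sup>2)"
  unfolding set_lebesgue_integral_def by (intro integral_nonneg_AE) auto

lemma rho_le:
  assumes "degree p \<le> N"
  shows "rho N \<Omega> \<le> (LINT z:\<Omega>|lebesgue. (cmod (cnj z - poly p z))\<^sup>2)"
  unfolding rho_def using assms
  by (intro cINF_lower bdd_belowI2[of _ 0] set_integral_error_nonneg) auto

lemma rho_ge:
  assumes "\<And>p. degree p \<le> N \<Longrightarrow> c \<le> (LINT z:\<Omega>|lebesgue. (cmod (cnj z - poly p z))\<^sup>2)"
  shows "c \<le> rho N \<Omega>"
  unfolding rho_def using assms by (intro cINF_greatest) (auto intro: exI[of _ 0])

lemma content_cbox_complex:
  assumes "Re u \<le> Re v" "Im u \<le> Im v"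
  shows "measure lebesgue (cbox u v) = (Re v - Re u) * (Im v - Im u)"
  using assms by (simp add: content_cbox_if Basis_complex_def box_eq_empty)

lemma rho_rectangle_le:
  assumes "1 \<le> N" "b > 0" "h > 0"
  shows "rho N (graph_strip b h (\<lambda>_. 0)) \<le> 16 * b * h ^ 3"
proof -
  let ?R = "graph_strip b h (\<lambda>_. 0)"
  let ?C = "cbox (Complex (- b) (- h)) (Complex b h)"
  have sub: "?R \<subseteq> ?C"
    by (auto simp: graph_strip_def in_cbox_complex_iff)
  have R: "open ?R" "bounded ?R"
    by (simp_all add: open_graph_strip bounded_graph_strip)
  \<comment> \<open>For \<open>p = [:0, 1:]\<close> the error is \<open>cnj z - z\<close>, of
    modulus \<open>2 * \<bar>Im z\<bar>\<close>, hence small on a thin rectangle.\<close>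
  have "rho N ?R \<le> (LINT z:?R|lebesgue. (cmod (cnj z - poly [:0, 1:] z))\<^sup>2)"
    using assms by (intro rho_le) simp
  also have "\<dots> \<le> (LINT z:?R|lebesgue. 4 * h\<^sup>2)"
  proof (intro set_integral_mono set_integrable_bounded_open R continuous_on_error continuous_on_const)
    fix z assume "z \<in> ?R"
    then have "\<bar>Im z\<bar> \<le> h" by (simp add: graph_strip_def)
    then have "(Im z)\<^sup>2 \<le> h\<^sup>2" by (simp add: abs_le_square_iff[symmetric])
    then show "(cmod (cnj z - poly [:0, 1:] z))\<^sup>2 \<le> 4 * h\<^sup>2"
      by (simp add: cmod_power2)
  qed
  also have "\<dots> = 4 * h\<^sup>2 * measure lebesgue ?R"
    using R by (simp add: set_lebesgue_integral_def)
  also have "measure lebesgue ?R \<le> measure lebesgue ?C"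
    using sub R by (intro measure_mono_fmeasurable) auto
  then have "4 * h\<^sup>2 * measure lebesgue ?R \<le> 4 * h\<^sup>2 * measure lebesgue ?C"
    by (intro mult_left_mono) auto
  also have "\<dots> = 16 * b * h ^ 3"
    using assms by (subst content_cbox_complex) (auto simp: power2_eq_square power3_eq_cube)
  finally show ?thesis .
qed

lemma poly_degree_le_2:
  fixes p :: "'a::comm_semiring_1 poly"
  assumes "degree p \<le> 2"
  shows "poly p x = coeff p 0 + coeff p 1 * x + coeff p 2 * x\<^sup>2"
proof -
  have "poly p x = (\<Sum>i\<le>2. coeff p i * x ^ i)"
    unfolding poly_altdef using assms
    by (intro sum.mono_neutral_left) (auto simp: coeff_eq_0)
  then show ?thesis by (simp add: numeral_2_eq_2)
qed

text \<open>The triangle inequality, then Cauchy-Schwarz against \<open>(1, 1, 1, 1)\<close>,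
  obtained from \<open>2 * x * y \<le> x\<^sup>2 + y\<^sup>2\<close> for the six pairs.\<close>

lemma norm_add4_squared_le:
  fixes a b c d :: "'a::real_normed_vector"
  shows "(norm (a + b + c + d))\<^sup>2 \<le> 4 * ((norm a)\<^sup>2 + (norm b)\<^sup>2 + (norm c)\<^sup>2 + (norm d)\<^sup>2)"
proof -
  have "norm (a + b + c + d) \<le> norm a + norm b + norm c + norm d"
    by norm
  then have "(norm (a + b + c + d))\<^sup>2 \<le> (norm a + norm b + norm c + norm d)\<^sup>2"
    by (intro power_mono) auto
  also have "\<dots> \<le> 4 * ((norm a)\<^sup>2 + (norm b)\<^sup>2 + (norm c)\<^sup>2 + (norm d)\<^sup>2)"
    using sum_squares_bound[of "norm a" "norm b"] sum_squares_bound[of "norm a" "norm c"]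
      sum_squares_bound[of "norm a" "norm d"] sum_squares_bound[of "norm b" "norm c"]
      sum_squares_bound[of "norm b" "norm d"] sum_squares_bound[of "norm c" "norm d"]
    by (simp add: power2_eq_square algebra_simps)
  finally show ?thesis .
qed

text \<open>Weighting the values at \<open>w + \<i>^k * a\<close> by \<open>\<i>^k\<close>
  multiplies the part of degree m in \<open>a\<close> by the sum of
  \<open>\<i>^(k * (m + 1))\<close> over \<open>k < 4\<close>, which vanishes for m = 0, 1, 2. On
  \<open>cnj\<close> the weights cancel the conjugated rotations and leave
  \<open>4 * cnj a\<close>.\<close>

lemma four_point_error_ge:
  assumes "degree p \<le> 2"
  defines "e \<equiv> \<lambda>z. cnj z - poly p z"
  shows "4 * (cmod a)\<^sup>2 \<le> (cmod (e (w + a)))\<^sup>2 + (cmod (e (w + \<i> * a)))\<^sup>2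
    + (cmod (e (w - a)))\<^sup>2 + (cmod (e (w - \<i> * a)))\<^sup>2"
proof -
  have "e (w + a) + \<i> * e (w + \<i> * a) + - e (w - a) + - \<i> * e (w - \<i> * a) = 4 * cnj a"
    unfolding e_def poly_degree_le_2[OF assms(1)]
    by (simp add: algebra_simps power2_eq_square)
  then show ?thesis
    using norm_add4_squared_le[of "e (w + a)" "\<i> * e (w + \<i> * a)" "- e (w - a)" "- \<i> * e (w - \<i> * a)"]
    by (simp add: norm_mult power_mult_distrib)
qed

lemma rho_ge_four_squares:
  assumes \<Omega>: "open \<Omega>" "bounded \<Omega>" and N: "N \<le> 2" and r: "r \<ge> 0"
    and sq: "\<And>c w. c \<in> {a, \<i> * a, - a, - (\<i> * a)} \<Longrightarrow> \<bar>Re w\<bar> \<le> r \<Longrightarrow> \<bar>Im w\<bar> \<le> r \<Longrightarrow> c + w \<in> \<Omega>"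
  shows "4 * r\<^sup>2 * (cmod a)\<^sup>2 \<le> rho N \<Omega>"
proof (rule rho_ge)
  fix p :: "complex poly" assume p: "degree p \<le> N"
  define F where "F z = (cmod (cnj z - poly p z))\<^sup>2" for z
  let ?S = "cbox (Complex (- r) (- r)) (Complex r r)"
  let ?I = "LINT z:\<Omega>|lebesgue. F z"
  have F: "continuous_on A F" for A
    unfolding F_def by (rule continuous_on_error)
  have F': "continuous_on A (\<lambda>w. F (w + c))" for A c
    by (rule continuous_on_compose2[OF F[of UNIV]]) (auto intro!: continuous_intros)
  have F0: "F z \<ge> 0" for z
    by (simp add: F_def)
  \<comment> \<open>Absolute integrability identifies the Lebesgue integral \<open>?I\<close> with
    the gauge integral, for which translation and monotonicity in the domain are applied
    below.\<close>
  have int: "F absolutely_integrable_on \<Omega>"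
    using set_integrable_bounded_open \<Omega> F by blast
  have *: "integral ?S (\<lambda>w. F (w + c)) \<le> ?I" if "c \<in> {a, \<i> * a, - a, - (\<i> * a)}" for c
  proof -
    let ?T = "cbox (Complex (- r) (- r) + c) (Complex r r + c)"
    have "z \<in> \<Omega>" if "z \<in> ?T" for z
      using sq[OF \<open>c \<in> _\<close>, of "z - c"] that by (auto simp: in_cbox_complex_iff abs_le_iff)
    then have "?T \<subseteq> \<Omega>" by blast
    then have "integral ?T F \<le> integral \<Omega> F"
      using int F F0
      by (intro integral_subset_le integrable_continuous) (auto simp: absolutely_integrable_on_def)
    moreover have "integral ?S (\<lambda>w. F (w + c)) = integral ?T F"
      using integral_shift_cbox[of "Complex (- r) (- r) + c" c "Complex r r + c" F] by simp
    ultimately show ?thesis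
      using set_lebesgue_integral_eq_integral(2)[OF int] by simp
  qed
  have "4 * r\<^sup>2 * (4 * (cmod a)\<^sup>2) = integral ?S (\<lambda>_. 4 * (cmod a)\<^sup>2)"
    using r content_cbox_complex[of "Complex (- r) (- r)" "Complex r r"]
    by (simp add: power2_eq_square)
  also have "\<dots> \<le> integral ?S (\<lambda>w. F (w + a) + F (w + \<i> * a) + F (w + - a) + F (w + - (\<i> * a)))"
    using four_point_error_ge[of p a] p N
    by (intro integral_le integrable_continuous continuous_intros F') (auto simp: F_def)
  also have "\<dots> = integral ?S (\<lambda>w. F (w + a)) + integral ?S (\<lambda>w. F (w + \<i> * a))
      + integral ?S (\<lambda>w. F (w + - a)) + integral ?S (\<lambda>w. F (w + - (\<i> * a)))"
    by (simp only: integral_add integrable_add integrable_continuous F')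
  \<comment> \<open>The translated squares may overlap, so each integral is bounded by
    \<open>?I\<close> separately; the resulting factor 4 cancels against the one on the
    left.\<close>
  also have "\<dots> \<le> 4 * ?I"
    using *[of a] *[of "\<i> * a"] *[of "- a"] *[of "- (\<i> * a)"] by simp
  finally show "4 * r\<^sup>2 * (cmod a)\<^sup>2 \<le> (LINT z:\<Omega>|lebesgue. (cmod (cnj z - poly p z))\<^sup>2)"
    by (simp add: F_def)
qed

section \<open>The counterexample\<close>

text \<open>Linear interpolation of the values at \<open>-2, -1, 1, 2\<close> that put the four points \<open>\<i>\<^sup>k (2 + \<i>)\<close> on
  the graph.\<close>
definition zigzag :: "real \<Rightarrow> real" where
  "zigzag x = 3 * x + 5 / 2 * (\<bar>x - 1\<bar> - \<bar>x + 1\<bar>)"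

lemma continuous_on_zigzag: "continuous_on A zigzag"
  unfolding zigzag_def [abs_def] by (intro continuous_intros)

text \<open>The slopes are -2 on \<open>[-1, 1]\<close> and 3 outside.\<close>

lemma zigzag_lipschitz: "\<bar>zigzag (x + t) - zigzag x\<bar> \<le> 3 * \<bar>t\<bar>"
  unfolding zigzag_def by (auto simp: abs_if field_simps)

lemma rho_zigzag_strip_ge:
  assumes "N \<le> 2" "0 < h" "h \<le> 1"
  shows "4 / 5 * h\<^sup>2 \<le> rho N (graph_strip 3 h zigzag)"
proof -
  \<comment> \<open>With \<open>r = h / 5\<close> the vertical deviation from the graph is at most
    \<open>h / 5 + 3 * h / 5 < h\<close>, and \<open>2 + h / 5 < 3\<close> keeps the squares within
    the horizontal range. As \<open>2 + \<i>\<close> has squared modulus 5, the constant becomes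
    \<open>4 / 5\<close>.\<close>
  have "4 * (h / 5)\<^sup>2 * (cmod (Complex 2 1))\<^sup>2 \<le> rho N (graph_strip 3 h zigzag)"
  proof (rule rho_ge_four_squares)
    fix c w assume c: "c \<in> {Complex 2 1, \<i> * Complex 2 1, - Complex 2 1, - (\<i> * Complex 2 1)}"
      and w: "\<bar>Re w\<bar> \<le> h / 5" "\<bar>Im w\<bar> \<le> h / 5"
    \<comment> \<open>The four rotated points have distinct real parts, so a single graph can
      contain them all.\<close>
    then have "(Re c, Im c) \<in> {(2, 1), (- 1, 2), (- 2, - 1), (1, - 2)}"
      by auto
    then have "\<bar>Re c\<bar> \<le> 2" "Im c = zigzag (Re c)"
      by (auto simp: zigzag_def)
    with w assms zigzag_lipschitz[of "Re c" "Re w"] show "c + w \<in> graph_strip 3 h zigzag"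
      unfolding graph_strip_def by (simp add: abs_le_iff abs_less_iff) linarith
  qed (use assms continuous_on_zigzag in \<open>auto intro: open_graph_strip bounded_graph_strip\<close>)
  then show ?thesis
    by (simp add: cmod_power2 power_divide)
qed

theorem corollary2p4:
  "\<forall>j \<in> {1, 2 :: nat}. \<exists>(\<Omega> :: complex set) (a :: complex) (u :: complex).
     open \<Omega> \<and> connected \<Omega> \<and> \<Omega> \<noteq> {} \<and> bounded \<Omega> \<and> simply_connected \<Omega> \<and>
     jordan_curve (frontier \<Omega>) \<and> norm u = 1 \<and>
     rho j (steiner_symmetrization a u \<Omega>) < rho j \<Omega>"
proof
  fix j :: nat assume j: "j \<in> {1, 2}"
  \<comment> \<open>Any positive \<open>h < 1 / 60\<close> gives
    \<open>48 * h ^ 3 < 4 / 5 * h\<^sup>2\<close>, where 48 is \<open>16 * b\<close> for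
    \<open>b = 3\<close>.\<close>
  define h :: real where "h = 1 / 100"
  let ?\<Omega> = "graph_strip 3 h zigzag"
  have h: "0 < h" "h \<le> 1" by (simp_all add: h_def)
  have "rho j (steiner_symmetrization 0 1 ?\<Omega>) \<le> 48 * h ^ 3"
    using rho_rectangle_le[of j 3 h] j h by (auto simp: steiner_symmetrization_graph_strip)
  also have "\<dots> < 4 / 5 * h\<^sup>2"
    by (simp add: h_def power2_eq_square power3_eq_cube)
  also have "\<dots> \<le> rho j ?\<Omega>"
    using j h by (intro rho_zigzag_strip_ge) auto
  finally have "rho j (steiner_symmetrization 0 1 ?\<Omega>) < rho j ?\<Omega>" .
  moreover have "0 \<in> ?\<Omega>"
    using h by (simp add: graph_strip_def zigzag_def)
  moreover have "simply_connected ?\<Omega>"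
    by (rule simply_connected_graph_strip[OF continuous_on_zigzag])
  ultimately show "\<exists>(\<Omega> :: complex set) (a :: complex) (u :: complex).
     open \<Omega> \<and> connected \<Omega> \<and> \<Omega> \<noteq> {} \<and> bounded \<Omega> \<and> simply_connected \<Omega> \<and>
     jordan_curve (frontier \<Omega>) \<and> norm u = 1 \<and>
     rho j (steiner_symmetrization a u \<Omega>) < rho j \<Omega>"
    using h continuous_on_zigzag
    by (intro exI[of _ ?\<Omega>] exI[of _ 0] exI[of _ 1])
      (auto intro: open_graph_strip bounded_graph_strip jordan_curve_frontier_graph_strip
        simply_connected_imp_connected)
qed

end
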